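(* Let $m\ge 1$ and $h\ge 2$ be integers. The function $\phi$ induces an injection from the open regions of the inside-out polytope $Q=\Delta_{m-1}\setminus\bigcup_{H\in\mathcal{H}_{m,h}}H$ to the coherent acyclic orientations of the graph $\Gamma_{m,h}$. That is, for $\mathbf{z}\in Q$ the orientation $\phi(\mathbf{z})$ is a coherent acyclic orientation of $\Gamma_{m,h}$ depending only on the region containing $\mathbf{z}$, and points in different regions have different images.
   Context: Notation: $[m]=\{1,\dots,m\}$, $\mathbb{N}=\{0,1,2,\dots\}$, and $\Delta_{m-1}=\{\mathbf{z}\in\mathbb{R}^m: z_1,\dots,z_m\ge 0,\ \sum_{i=1}^m z_i=1\}$. A consecutive subset of $[m]$ is a nonempty set of the form $\{j,j+1,\dots,k\}$; it is proper if it is not equal to $[m]$. Arrangement: $\mathcal{H}_{m,h}$ is the set of all nondegenerate hyperplanes of $\mathbb{R}^m$ (i.e. the equation is not identically satisfied) of the form $$\sum_{k=1}^{\ell}\Big(\sum_{j\in U_k}z_j\Big)=\sum_{k=\ell+1}^{h'}\Big(\sum_{j\in U_k}z_j\Big),$$ where $0\le \ell\le h'\le h$ and $U_1,\dots,U_{h'}$ are (not necessarily distinct) proper consecutive subsets of $[m]$; empty sums are $0$. A region is a connected component of $Q=\Delta_{m-1}\setminus\bigcup_{H\in\mathcal{H}_{m,h}}H$, and an open region is the relative interior of a region. Climb: for $\mathbf{a}=(a_1,\dots,a_m)\in\mathbb{N}^m$, with $a_0:=0$, $\operatorname{climb}(\mathbf{a})=\sum_{j=1}^m\operatorname{climb}_j(\mathbf{a})$,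 where $\operatorname{climb}_j(\mathbf{a})=a_j-a_{j-1}$ if $a_{j-1}<a_j$ and $0$ otherwise. The support of $\mathbf{a}$ is $\operatorname{supp}(\mathbf{a})=\{i:a_i\neq 0\}$. Graph: $M_h$ is the (finite) set of vectors in $\mathbb{N}^m$ of climb at most $h$. $\Gamma_{m,h}$ is the undirected graph with vertex set $M_h$ in which two distinct vertices $\mathbf{u},\mathbf{v}$ form an edge if, when we write $\mathbf{u}=\mathbf{a}+\mathbf{c}$, $\mathbf{v}=\mathbf{b}+\mathbf{c}$ with $\mathbf{a},\mathbf{b},\mathbf{c}\in\mathbb{N}^m$ and $\operatorname{supp}(\mathbf{a})\cap\operatorname{supp}(\mathbf{b})=\emptyset$ (this is possible in a unique way), we have $\operatorname{climb}(\mathbf{a})+\operatorname{climb}(\mathbf{b})\le h$. Coherence: an orientation of all edges of $\Gamma_{m,h}$ is coherent if (i) every edge $\mathbf{0}\mathbf{u}$ is oriented from $\mathbf{0}$ to $\mathbf{u}$, and (ii) for all distinct $\mathbf{a},\mathbf{b}\in\mathbb{N}^m$ with $\operatorname{climb}(\mathbf{a})+\operatorname{climb}(\mathbf{b})\le h$ and every $\mathbf{c}\in\mathbb{N}^m$ such that $\mathbf{u}=\mathbf{a}+\mathbf{c}$ and $\mathbf{v}=\mathbf{b}+\mathbf{c}$ belong to $M_h$, the orientation of $\mathbf{u}\mathbf{v}$ agrees with that of $\mathbf{a}\mathbf{b}$ (that is, $\mathbf{u}\to\mathbf{v}$ if and only if $\mathbf{a}\to\mathbf{b}$). It is acyclic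 if it has no directed cycle. The map $\phi$: for $\mathbf{z}=(z_1,\dots,z_m)\in Q$, $\phi(\mathbf{z})$ orients each edge $\mathbf{u}\mathbf{v}$ of $\Gamma_{m,h}$ as $\mathbf{u}\to\mathbf{v}$ if $\sum_{i=1}^m u_iz_i<\sum_{i=1}^m v_iz_i$. *)

theory Defs
  imports "HOL-Analysis.Analysis"
begin

text \<open>
  The index set $[m]$ is an arbitrary finite linearly ordered type \<open>'m\<close>, with \<open>m = CARD('m) \<ge> 1\<close>;
  its order plays the role of $1 < \dots < m$.
\<close>

definition std_simplex :: "(real^'m::finite) set" where
  "std_simplex = {z. (\<forall>i. 0 \<le> z $ i) \<and> (\<Sum>i\<in>UNIV. z $ i) = 1}"

definition proper_consecutive :: "'m::{finite,linorder} set \<Rightarrow> bool" where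
  "proper_consecutive S \<longleftrightarrow> (\<exists>j k. j \<le> k \<and> S = {j..k}) \<and> S \<noteq> UNIV"

text \<open>A hyperplane is identified with its solution set; nondegenerate means that this set is
  not the whole space.\<close>

definition arrangement :: "nat \<Rightarrow> (real^'m::{finite,linorder}) set set" where
  "arrangement h = {H. H \<noteq> UNIV \<and>
     (\<exists>l h' U. l \<le> h' \<and> h' \<le> h \<and> (\<forall>k\<in>{1..h'}. proper_consecutive (U k)) \<and>
        H = {z. (\<Sum>k\<in>{1..l}. \<Sum>j\<in>U k. z $ j) = (\<Sum>k\<in>{l+1..h'}. \<Sum>j\<in>U k. z $ j)})}"

definition inside_out :: "nat \<Rightarrow> (real^'m::{finite,linorder}) set" where
  "inside_out h = std_simplex - \<Union>(arrangement h)"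

definition regions :: "nat \<Rightarrow> (real^'m::{finite,linorder}) set set" where
  "regions h = components (inside_out h)"

definition open_regions :: "nat \<Rightarrow> (real^'m::{finite,linorder}) set set" where
  "open_regions h = rel_interior ` regions h"

text \<open>The entry preceding position \<open>j\<close>, with the convention $a_0 = 0$.\<close>

definition prev_entry :: "nat^'m::{finite,linorder} \<Rightarrow> 'm \<Rightarrow> nat" where
  "prev_entry a j = (if {i. i < j} = {} then 0 else a $ Max {i. i < j})"

definition climb_at :: "nat^'m::{finite,linorder} \<Rightarrow> 'm \<Rightarrow> nat" where
  "climb_at a j = (if prev_entry a j < a $ j then a $ j - prev_entry a j else 0)"

definition climb :: "nat^'m::{finite,linorder} \<Rightarrow> nat" where
  "climb a = (\<Sum>j\<in>UNIV. climb_at a j)"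

definition vsupp :: "nat^'m::finite \<Rightarrow> 'm set" where
  "vsupp a = {i. a $ i \<noteq> 0}"

definition climb_verts :: "nat \<Rightarrow> (nat^'m::{finite,linorder}) set" where
  "climb_verts h = {a. climb a \<le> h}"

definition climb_edges :: "nat \<Rightarrow> (nat^'m::{finite,linorder}) set set" where
  "climb_edges h = {{u, v} | u v. u \<in> climb_verts h \<and> v \<in> climb_verts h \<and> u \<noteq> v \<and>
     (\<exists>a b c. u = a + c \<and> v = b + c \<and> vsupp a \<inter> vsupp b = {} \<and> climb a + climb b \<le> h)}"

text \<open>An orientation of a set of (two-element) edges is given by its set of arcs, where \<open>(u, v)\<close>
  stands for $u \to v$.\<close>

definition is_orientation :: "'v set set \<Rightarrow> ('v \<times> 'v) set \<Rightarrow> bool" where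
  "is_orientation E D \<longleftrightarrow> (\<forall>u v. (u, v) \<in> D \<longrightarrow> {u, v} \<in> E) \<and>
     (\<forall>u v. {u, v} \<in> E \<longrightarrow> ((u, v) \<in> D \<longleftrightarrow> (v, u) \<notin> D))"

definition coherent :: "nat \<Rightarrow> ((nat^'m::{finite,linorder}) \<times> (nat^'m::{finite,linorder})) set \<Rightarrow> bool" where
  "coherent h D \<longleftrightarrow> (\<forall>u. {0, u} \<in> climb_edges h \<longrightarrow> (0, u) \<in> D) \<and>
     (\<forall>a b c. a \<noteq> b \<longrightarrow> climb a + climb b \<le> h \<longrightarrow>
        a + c \<in> climb_verts h \<longrightarrow> b + c \<in> climb_verts h \<longrightarrow>
        ((a + c, b + c) \<in> D \<longleftrightarrow> (a, b) \<in> D))"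

definition coherent_acyclic_orientations ::
    "nat \<Rightarrow> ((nat^'m::{finite,linorder}) \<times> (nat^'m::{finite,linorder})) set set" where
  "coherent_acyclic_orientations h =
     {D. is_orientation (climb_edges h) D \<and> coherent h D \<and> acyclic D}"

definition phi :: "nat \<Rightarrow> real^'m::{finite,linorder} \<Rightarrow> ((nat^'m::{finite,linorder}) \<times> (nat^'m::{finite,linorder})) set" where
  "phi h z = {(u, v). {u, v} \<in> climb_edges h \<and>
     (\<Sum>i\<in>UNIV. real (u $ i) * z $ i) < (\<Sum>i\<in>UNIV. real (v $ i) * z $ i)}"

end

theory Submission
  imports Defs
begin

text \<open>
  A vector \<open>a\<close> is a sum of \<open>climb a\<close> indicator vectors of consecutive subsets of its support, and
  any sum of \<open>n\<close> such indicators has climb at most \<open>n\<close>. Hence an edge between nonzero vectors \<open>a\<close>, \<open>b\<close>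
  with disjoint supports defines a hyperplane \<open>a \<bullet> z = b \<bullet> z\<close> of the arrangement, and every
  hyperplane of the arrangement comes from an edge. So no edge form changes sign on a
  region, while if two points of \<open>Q\<close> induce the same orientation, the segment
  between them meets no hyperplane. In particular the regions are convex, so each has a nonempty
  relative interior.
\<close>

section \<open>Climb\<close>

text \<open>Every entrywise climb computation splits this way: a first index with value 0 before it,
  or an immediate predecessor \<open>p\<close>. As \<open>p\<close> does not depend on the vector,
  one split serves several vectors at once.\<close>

lemma prev_entry_cases:
  fixes j :: "'m::{finite,linorder}"
  obtains "\<forall>q. \<not> q < j" "\<And>x :: nat^'m::{finite,linorder}. prev_entry x j = 0"
  | p where "p < j" "\<And>q. q < j \<longleftrightarrow> q \<le> p" "\<And>x :: nat^'m::{finite,linorder}. prev_entry x j = x $ p"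
proof (cases "{i. i < j} = {}")
  case True
  with that(1) show thesis by (auto simp: prev_entry_def)
next
  case False
  define p where "p = Max {i. i < j}"
  have "p < j" using Max_in[OF _ False] by (simp add: p_def)
  moreover have "q \<le> p" if "q < j" for q using that by (simp add: p_def)
  ultimately have "q < j \<longleftrightarrow> q \<le> p" for q using le_less_trans by blast
  moreover have "prev_entry x j = x $ p" for x
    using False by (simp only: prev_entry_def p_def if_False)
  ultimately show thesis using that(2) \<open>p < j\<close> by blast
qed

lemma climb_at_eq: "climb_at a j = a $ j - prev_entry a j"
  by (simp add: climb_at_def)

text \<open>The sum telescopes down to the convention that 0 precedes the first entry. The induction
  is on the size of the initial segment, and the integers allow for falls.\<close>

lemma sum_prev_entry_telescope:
  fixes a :: "nat^'m::{finite,linorder}"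
  shows "(\<Sum>j\<in>{..k}. int (a $ j) - int (prev_entry a j)) = int (a $ k)"
proof (induction "card {..k}" arbitrary: k rule: less_induct)
  case less
  show ?case
  proof (cases k rule: prev_entry_cases)
    case 1
    then have "{..k} = {k}" by (auto simp: not_less intro: antisym)
    with 1 show ?thesis by simp
  next
    case (2 p)
    then have eq: "{..k} = insert k {..p}" and k: "k \<notin> {..p}" by (auto simp: order_le_less)
    have "card {..p} < card {..k}" unfolding eq using k by simp
    from less[OF this] show ?thesis unfolding eq using k 2 by simp
  qed
qed

text \<open>Pad the sequence by 0 at both ends: total rise equals total fall, so twice the climb is
  the total variation. The last summand is the final fall back to 0.\<close>

lemma climb_variation:
  fixes a :: "nat^'m::{finite,linorder}"
  shows "2 * int (climb a) =
    (\<Sum>j\<in>UNIV. \<bar>int (a $ j) - int (prev_entry a j)\<bar>) + int (a $ Max UNIV)"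
proof -
  have "{..Max (UNIV :: 'm set)} = UNIV" by auto
  then have "int (a $ Max UNIV) = (\<Sum>j\<in>UNIV. int (a $ j) - int (prev_entry a j))"
    using sum_prev_entry_telescope[of a "Max UNIV"] by simp
  \<comment> \<open>The positive part of an integer \<open>x\<close> is half of
    \<open>\<bar>x\<bar> + x\<close>.\<close>
  moreover have "2 * int (climb_at a j) = \<bar>int (a $ j) - int (prev_entry a j)\<bar> +
      (int (a $ j) - int (prev_entry a j))" for j
    by (simp add: climb_at_eq)
  ultimately show ?thesis
    by (simp add: climb_def sum_distrib_left sum.distrib del: sum_subtractf)
qed

lemma climb_0 [simp]: "climb 0 = 0"
  by (simp add: climb_def climb_at_eq)

lemma climb_add_le: "climb (a + b) \<le> climb a + climb b"
  unfolding climb_def sum.distrib[symmetric]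
proof (rule sum_mono)
  fix j
  show "climb_at (a + b) j \<le> climb_at a j + climb_at b j"
    by (cases j rule: prev_entry_cases) (auto simp: climb_at_eq)
qed

text \<open>The only possible rise is at \<open>j\<close>. If \<open>k < j\<close> the vector is
  zero, hence an inequality.\<close>

lemma climb_interval_le: "climb (\<chi> i. if i \<in> {j..k} then 1 else 0) \<le> 1"
proof -
  let ?a = "\<chi> i. if i \<in> {j..k} then 1 else (0::nat)"
  have "climb_at ?a i \<le> (if i = j then 1 else 0)" for i
  proof (cases "j < i \<and> i \<le> k")
    case True
    show ?thesis
    proof (cases i rule: prev_entry_cases)
      case 1
      with True show ?thesis by simp
    next
      case (2 p)
      then have "p \<le> k" using True by (meson less_imp_le less_le_trans)
      with 2(2,3) True show ?thesis by (simp add: climb_at_eq)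
    qed
  next
    case False
    then show ?thesis by (auto simp: climb_at_eq)
  qed
  then have "climb ?a \<le> (\<Sum>i\<in>UNIV. if i = j then 1 else 0)"
    unfolding climb_def by (intro sum_mono)
  then show ?thesis by simp
qed

text \<open>Subtraction is truncated, so \<open>a - b\<close> and \<open>b - a\<close> are the positive and negative parts of
  the difference; splitting into these preserves total variation.\<close>

lemma climb_diff_le: "climb (a - b) + climb (b - a) \<le> climb a + climb b"
proof -
  let ?d = "\<lambda>a j. \<bar>int (a $ j) - int (prev_entry a j)\<bar>"
  have "?d (a - b) j + ?d (b - a) j \<le> ?d a j + ?d b j" for j
    by (cases j rule: prev_entry_cases) auto
  then have "(\<Sum>j\<in>UNIV. ?d (a - b) j + ?d (b - a) j) \<le> (\<Sum>j\<in>UNIV. ?d a j + ?d b j)"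
    by (intro sum_mono)
  \<comment> \<open>In the last entries, the two truncated differences add up to the absolute
    difference, which is at most the sum.\<close>
  then show ?thesis
    using climb_variation[of "a - b"] climb_variation[of "b - a"]
      climb_variation[of a] climb_variation[of b]
    by (simp add: sum.distrib)
qed

text \<open>Take the leftmost maximal run of the support and lower it by one. Differences inside the
  run are unchanged, the rise at its start drops by one, and its end is followed by a zero or by
  nothing, so no new rise appears.\<close>

lemma climb_peel:
  fixes a :: "nat^'m::{finite,linorder}"
  assumes "a \<noteq> 0"
  obtains j k b where "j \<le> k" "{j..k} \<subseteq> vsupp a"
    "a = b + (\<chi> i. if i \<in> {j..k} then 1 else 0)" "climb a = Suc (climb b)"
proof -
  have ne: "vsupp a \<noteq> {}" using assms by (auto simp: vsupp_def vec_eq_iff)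
  define j where "j = Min (vsupp a)"
  have j: "j \<in> vsupp a" using Min_in[OF _ ne] by (simp add: j_def)
  have below: "a $ i = 0" if "i < j" for i
  proof (rule ccontr)
    assume "a $ i \<noteq> 0"
    then have "j \<le> i" unfolding j_def by (intro Min_le) (auto simp: vsupp_def)
    with that show False by simp
  qed
  define K where "K = {k. j \<le> k \<and> {j..k} \<subseteq> vsupp a}"
  define k where "k = Max K"
  have "j \<in> K" using j by (simp add: K_def)
  then have "k \<in> K" unfolding k_def by (intro Max_in) auto
  then have jk: "j \<le> k" "{j..k} \<subseteq> vsupp a" by (auto simp: K_def)
  have pos: "0 < a $ i" if "j \<le> i" "i \<le> k" for i
    using jk that by (auto simp: vsupp_def)
  \<comment> \<open>The second premise makes \<open>i\<close> the immediate successor of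
    \<open>k\<close>; a nonzero entry there would extend the run.\<close>
  have after: "a $ i = 0" if "k < i" "\<And>q. q < i \<longleftrightarrow> q \<le> k" for i
  proof (rule ccontr)
    assume "a $ i \<noteq> 0"
    have "i \<in> K"
      unfolding K_def using jk that \<open>a $ i \<noteq> 0\<close>
      by (auto simp: vsupp_def subset_iff order_le_less[of _ i])
    then have "i \<le> k" by (simp add: k_def)
    with \<open>k < i\<close> show False by simp
  qed
  define b where "b = (\<chi> i. a $ i - (if i \<in> {j..k} then 1 else 0))"
  have "climb_at a i = climb_at b i + (if i = j then 1 else 0)" for i
  proof (cases i rule: prev_entry_cases)
    case 1
    then have "i \<le> j" by (auto simp: not_less)
    show ?thesis
    proof (cases "i = j")
      case True
      then show ?thesis using 1 jk pos[of j] by (simp add: climb_at_eq b_def)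
    next
      case False
      then show ?thesis using 1 \<open>i \<le> j\<close> by (simp add: climb_at_eq b_def)
    qed
  next
    case (2 p)
    \<comment> \<open>The index lies before the run, at its start, further inside, right after its
      end, or beyond that.\<close>
    consider "i < j" | "i = j" | "j < i" "i \<le> k" | "k < i" "p = k" | "k < i" "k < p"
      using 2 by (metis antisym_conv3 leI order_le_less)
    then show ?thesis
    proof cases
      case 1
      then have "\<not> j \<le> i" "\<not> j \<le> p" "i \<noteq> j" using 2(1) by auto
      with 2 show ?thesis by (simp add: climb_at_eq b_def)
    next
      case i: 2
      with 2 show ?thesis using below[of p] pos[of j] jk by (simp add: climb_at_eq b_def)
    next
      case 3
      have "j \<le> i" "j \<le> p" "p \<le> k" using 2(2)[of j] 3 less_le_trans[OF 2(1) 3(2)] by auto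
      with 2 3 show ?thesis using pos[of p] pos[of i] by (auto simp: climb_at_eq b_def)
    next
      case 4
      with 2 jk show ?thesis using after[of i] by (auto simp: climb_at_eq b_def)
    next
      case 5
      then have "\<not> i \<le> k" "\<not> p \<le> k" "i \<noteq> j" using jk(1) by auto
      with 2 show ?thesis by (auto simp: climb_at_eq b_def)
    qed
  qed
  then have "climb a = Suc (climb b)" by (simp add: climb_def sum.distrib)
  moreover have "a = b + (\<chi> i. if i \<in> {j..k} then 1 else 0)"
    using pos by (auto simp: vec_eq_iff b_def Suc_le_eq)
  ultimately show thesis using that jk by blast
qed

section \<open>Linear forms\<close>

definition lform :: "nat^'m::finite \<Rightarrow> real^'m::finite \<Rightarrow> real" where
  "lform a z = (\<Sum>i\<in>UNIV. real (a $ i) * z $ i)"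

lemma lform_0 [simp]: "lform 0 z = 0"
  by (simp add: lform_def)

lemma lform_add: "lform (a + b) z = lform a z + lform b z"
  by (simp add: lform_def algebra_simps sum.distrib)

lemma lform_indicator: "lform (\<chi> i. if i \<in> S then 1 else 0) z = (\<Sum>j\<in>S. z $ j)"
proof -
  have "lform (\<chi> i. if i \<in> S then 1 else 0) z = (\<Sum>j\<in>UNIV. if j \<in> S then z $ j else 0)"
    unfolding lform_def by (intro sum.cong) auto
  then show ?thesis by (simp add: sum.If_cases)
qed

text \<open>Basis vectors recover the coefficients, so distinct vectors give distinct forms and a
  nondegenerate equation.\<close>

lemma lform_axis: "lform a (axis i 1) = real (a $ i)"
  by (simp add: lform_def axis_def if_distrib cong: if_cong)

lemma continuous_on_lform: "continuous_on S (lform a)"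
  unfolding lform_def by (intro continuous_intros)

text \<open>Peeling intervals one at a time uses exactly \<open>climb a\<close> of them. That they
  stay inside the support later makes them proper.\<close>

lemma lform_decompose:
  fixes a :: "nat^'m::{finite,linorder}"
  obtains U where "\<And>k. k \<in> {1..climb a} \<Longrightarrow> (\<exists>i j. i \<le> j \<and> U k = {i..j}) \<and> U k \<subseteq> vsupp a"
    "\<And>z. lform a z = (\<Sum>k\<in>{1..climb a}. \<Sum>j\<in>U k. z $ j)"
proof (induction "climb a" arbitrary: a thesis)
  case 0
  have "a = 0"
  proof (rule ccontr)
    assume "a \<noteq> 0"
    then show False by (rule climb_peel) (use 0(1) in simp)
  qed
  then show ?case by (intro 0(2)[of "\<lambda>_. {}"]) auto
next
  case (Suc n)
  then have "a \<noteq> 0" by auto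
  then obtain j k b where b: "j \<le> k" "{j..k} \<subseteq> vsupp a"
    "a = b + (\<chi> i. if i \<in> {j..k} then 1 else 0)" "climb a = Suc (climb b)"
    by (rule climb_peel)
  with Suc.hyps(2) have n: "n = climb b" by simp
  obtain U where U: "\<And>k. k \<in> {1..climb b} \<Longrightarrow> (\<exists>i j. i \<le> j \<and> U k = {i..j}) \<and> U k \<subseteq> vsupp b"
    "\<And>z. lform b z = (\<Sum>k\<in>{1..climb b}. \<Sum>j\<in>U k. z $ j)"
    by (rule Suc.hyps(1)[OF n]) (rule that)
  have sub: "vsupp b \<subseteq> vsupp a" unfolding b(3) by (auto simp: vsupp_def)
  define V where "V = U(Suc n := {j..k})"
  show ?case
  proof (rule Suc.prems[of V])
    fix i assume i: "i \<in> {1..climb a}"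
    show "(\<exists>p q. p \<le> q \<and> V i = {p..q}) \<and> V i \<subseteq> vsupp a"
    proof (cases "i = Suc n")
      case True
      then show ?thesis using b(1,2) by (auto simp: V_def)
    next
      case False
      then show ?thesis using U(1)[of i] i sub b(4) n by (auto simp: V_def)
    qed
  next
    fix z
    have "(\<Sum>k\<in>{1..n}. \<Sum>j\<in>V k. z $ j) = lform b z"
      unfolding U(2) n[symmetric] by (intro sum.cong) (auto simp: V_def)
    moreover have "lform a z = lform b z + (\<Sum>j\<in>{j..k}. z $ j)"
      by (subst b(3)) (simp only: lform_add lform_indicator)
    ultimately show "lform a z = (\<Sum>k\<in>{1..climb a}. \<Sum>j\<in>V k. z $ j)"
      by (simp add: b(4) n[symmetric] V_def)
  qed
qed

text \<open>Add the indicators one by one; climb is subadditive and each contributes at most 1.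
  Adjacent intervals may merge, so the climb can be smaller than the number of intervals.\<close>

lemma lform_compose:
  fixes U :: "'i \<Rightarrow> 'm::{finite,linorder} set"
  assumes "finite I" "\<And>k. k \<in> I \<Longrightarrow> \<exists>i j. U k = {i..j}"
  obtains a where "climb a \<le> card I" "\<And>z. lform a z = (\<Sum>k\<in>I. \<Sum>j\<in>U k. z $ j)"
  using assms
proof (induction I arbitrary: thesis rule: finite_induct)
  case empty
  then show ?case using climb_0 lform_0 by (metis card.empty le_refl sum.empty)
next
  case (insert x I)
  obtain a where a: "climb a \<le> card I" "\<And>z. lform a z = (\<Sum>k\<in>I. \<Sum>j\<in>U k. z $ j)"
    using insert.IH insert.prems(2) by blast
  obtain i j where ij: "U x = {i..j}" using insert.prems(2) by blast
  let ?e = "\<chi> q. if q \<in> {i..j} then 1 else (0::nat)"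
  show ?case
  proof (rule insert.prems(1)[of "a + ?e"])
    show "climb (a + ?e) \<le> card (insert x I)"
      using climb_add_le[of a ?e] climb_interval_le[of i j] a(1) insert.hyps by simp
    show "lform (a + ?e) z = (\<Sum>k\<in>insert x I. \<Sum>j\<in>U k. z $ j)" for z
      using insert.hyps ij by (simp only: lform_add lform_indicator a(2)) simp
  qed
qed

section \<open>Edges and hyperplanes\<close>

text \<open>Disjointness of supports comes for free: moving the common part of \<open>a\<close> and
  \<open>b\<close> into the third summand does not increase the total climb. Coherence is phrased
  for such general \<open>a\<close> and \<open>b\<close>.\<close>

lemma climb_edgeI:
  assumes "a \<noteq> b" "climb a + climb b \<le> h" "a + c \<in> climb_verts h" "b + c \<in> climb_verts h"
  shows "{a + c, b + c} \<in> climb_edges h"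
proof -
  let ?c = "(\<chi> i. min (a $ i) (b $ i)) + c"
  have "a + c = (a - b) + ?c" "b + c = (b - a) + ?c" by (auto simp: vec_eq_iff)
  moreover have "vsupp (a - b) \<inter> vsupp (b - a) = {}" by (auto simp: vsupp_def)
  moreover have "climb (a - b) + climb (b - a) \<le> h" using climb_diff_le[of a b] assms(2) by simp
  moreover have "a + c \<noteq> b + c" using assms(1) by (simp add: vec_eq_iff)
  ultimately show ?thesis unfolding climb_edges_def using assms(3,4) by blast
qed

text \<open>The coordinate hyperplanes belong to the arrangement, so points of \<open>Q\<close> have
  positive coordinates.\<close>

lemma lform_pos:
  fixes b :: "nat^'m::{finite,linorder}"
  assumes "z \<in> inside_out h" "h \<ge> 1" "b \<noteq> 0"
  shows "lform b z > 0"
proof -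
  have z: "\<And>i. 0 \<le> z $ i" "(\<Sum>i\<in>UNIV. z $ i) = 1"
    using assms(1) by (auto simp: inside_out_def std_simplex_def)
  obtain i where i: "b $ i \<noteq> 0" using assms(3) by (auto simp: vec_eq_iff)
  have "z $ i \<noteq> 0"
  \<comment> \<open>For \<open>m = 1\<close> the singleton is not proper, but then the only
    coordinate equals 1.\<close>
  proof (cases "{i} = UNIV")
    case True
    then show ?thesis using z(2) by (simp flip: True)
  next
    case False
    let ?H = "{z :: real^'m::{finite,linorder}. z $ i = 0}"
    have "axis i 1 \<notin> ?H" by simp
    then have "?H \<noteq> UNIV" by blast
    moreover have "proper_consecutive {i}"
      using False unfolding proper_consecutive_def by (metis atLeastAtMost_singleton order_refl)
    ultimately have "?H \<in> arrangement h"
      unfolding arrangement_def using assms(2)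
      by (intro CollectI conjI exI[of _ 1] exI[of _ "\<lambda>_. {i}"]) auto
    then show ?thesis using assms(1) by (auto simp: inside_out_def)
  qed
  with z(1)[of i] i have "0 < real (b $ i) * z $ i" by simp
  then show ?thesis unfolding lform_def using z(1) by (intro sum_pos2[of _ i]) auto
qed

text \<open>After cancelling the common summand, two nonzero vectors with disjoint supports
  decompose into at most \<open>h\<close> proper intervals, so equality of the forms is a hyperplane
  of the arrangement.\<close>

lemma edge_lform_neq:
  fixes u v :: "nat^'m::{finite,linorder}"
  assumes "{u, v} \<in> climb_edges h" "z \<in> inside_out h" "h \<ge> 1"
  shows "lform u z \<noteq> lform v z"
proof -
  have *: "lform a z \<noteq> lform b z"
    if "a \<noteq> b" and disj: "vsupp a \<inter> vsupp b = {}" and le: "climb a + climb b \<le> h"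
    for a b :: "nat^'m::{finite,linorder}"
  proof -
    \<comment> \<open>If one vector is 0, the other may have full support and its intervals need not
      be proper; positivity on \<open>Q\<close> replaces the hyperplane.\<close>
    consider "a = 0" "b \<noteq> 0" | "a \<noteq> 0" "b = 0" | "a \<noteq> 0" "b \<noteq> 0" using \<open>a \<noteq> b\<close> by auto
    then show ?thesis
    proof cases
      case 1
      then show ?thesis using lform_pos[OF assms(2,3), of b] by simp
    next
      case 2
      then show ?thesis using lform_pos[OF assms(2,3), of a] by simp
    next
      case 3
      obtain U where U: "\<And>k. k \<in> {1..climb a} \<Longrightarrow> (\<exists>i j. i \<le> j \<and> U k = {i..j}) \<and> U k \<subseteq> vsupp a"
        "\<And>z. lform a z = (\<Sum>k\<in>{1..climb a}. \<Sum>j\<in>U k. z $ j)" by (rule lform_decompose[of a]) (rule that)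
      obtain V where V: "\<And>k. k \<in> {1..climb b} \<Longrightarrow> (\<exists>i j. i \<le> j \<and> V k = {i..j}) \<and> V k \<subseteq> vsupp b"
        "\<And>z. lform b z = (\<Sum>k\<in>{1..climb b}. \<Sum>j\<in>V k. z $ j)" by (rule lform_decompose[of b]) (rule that)
      \<comment> \<open>Each support misses the other one, which is nonempty.\<close>
      have proper: "vsupp a \<noteq> UNIV" "vsupp b \<noteq> UNIV"
        using 3 disj by (auto simp: vsupp_def vec_eq_iff)
      \<comment> \<open>\<open>W\<close> concatenates the two families: the first
        \<open>climb a\<close> indices form the left side of the equation, the rest the right
        side.\<close>
      define W where "W = (\<lambda>k. if k \<le> climb a then U k else V (k - climb a))"
      let ?h = "climb a + climb b"
      have "proper_consecutive (W k)" if "k \<in> {1..?h}" for k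
      proof (cases "k \<le> climb a")
        case True
        then show ?thesis using U(1)[of k] that proper
          by (auto simp: W_def proper_consecutive_def)
      next
        case False
        then have "k - climb a \<in> {1..climb b}" using that by auto
        from V(1)[OF this] show ?thesis using False proper
          by (auto simp: W_def proper_consecutive_def)
      qed
      moreover have a: "lform a z = (\<Sum>k\<in>{1..climb a}. \<Sum>j\<in>W k. z $ j)" for z
        unfolding U(2) by (intro sum.cong) (auto simp: W_def)
      moreover have b: "lform b z = (\<Sum>k\<in>{climb a + 1..?h}. \<Sum>j\<in>W k. z $ j)" for z
      proof -
        have "(\<Sum>k\<in>{1 + climb a..climb b + climb a}. \<Sum>j\<in>W k. z $ j) =
            (\<Sum>k\<in>{1..climb b}. \<Sum>j\<in>W (k + climb a). z $ j)"
          by (rule sum.shift_bounds_cl_nat_ivl)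
        also have "\<dots> = lform b z" unfolding V(2) by (intro sum.cong) (auto simp: W_def)
        finally show ?thesis by (simp add: add.commute)
      qed
      moreover have "{z. lform a z = lform b z} \<noteq> UNIV"
      proof -
        obtain i where "a $ i \<noteq> b $ i" using \<open>a \<noteq> b\<close> by (auto simp: vec_eq_iff)
        then have "axis i 1 \<notin> {z. lform a z = lform b z}" by (simp add: lform_axis)
        then show ?thesis by blast
      qed
      ultimately have "{z. lform a z = lform b z} \<in> arrangement h"
        unfolding arrangement_def using le
        by (intro CollectI conjI exI[of _ "climb a"] exI[of _ ?h] exI[of _ W]) auto
      then show ?thesis using assms(2) by (auto simp: inside_out_def)
    qed
  qed
  obtain a b c where "u = a + c \<and> v = b + c \<or> v = a + c \<and> u = b + c" "u \<noteq> v"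
    "vsupp a \<inter> vsupp b = {}" "climb a + climb b \<le> h"
    using assms(1) unfolding climb_edges_def by (fastforce simp: doubleton_eq_iff)
  with *[of a b] show ?thesis by (auto simp: lform_add)
qed

text \<open>Composing the intervals of each side yields the two endpoints; they differ because the
  equation is nondegenerate.\<close>

lemma hyperplane_edge:
  fixes H :: "(real^'m::{finite,linorder}) set"
  assumes "H \<in> arrangement h"
  obtains a b where "{a, b} \<in> climb_edges h" "H = {z. lform a z = lform b z}"
proof -
  obtain l h' U where H: "H \<noteq> UNIV" "l \<le> h'" "h' \<le> h"
    "\<And>k. k \<in> {1..h'} \<Longrightarrow> proper_consecutive (U k)"
    "H = {z. (\<Sum>k\<in>{1..l}. \<Sum>j\<in>U k. z $ j) = (\<Sum>k\<in>{l+1..h'}. \<Sum>j\<in>U k. z $ j)}"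
    using assms unfolding arrangement_def by blast
  have iv: "\<exists>i j. U k = {i..j}" if "k \<in> {1..h'}" for k
    using H(4)[OF that] by (auto simp: proper_consecutive_def)
  obtain a where a: "climb a \<le> card {1..l}" "\<And>z. lform a z = (\<Sum>k\<in>{1..l}. \<Sum>j\<in>U k. z $ j)"
    by (rule lform_compose[of "{1..l}" U]) (use iv H(2) in auto)
  obtain b where b: "climb b \<le> card {l+1..h'}"
    "\<And>z. lform b z = (\<Sum>k\<in>{l+1..h'}. \<Sum>j\<in>U k. z $ j)"
    by (rule lform_compose[of "{l+1..h'}" U]) (use iv H(2) in auto)
  have Heq: "H = {z. lform a z = lform b z}" using H(5) a(2) b(2) by simp
  have "climb a + climb b \<le> h" using a(1) b(1) H(2,3) by simp
  moreover have "a \<noteq> b" using Heq H(1) by auto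
  ultimately have "{a + 0, b + 0} \<in> climb_edges h"
    by (intro climb_edgeI) (auto simp: climb_verts_def)
  with that Heq show thesis by simp
qed

section \<open>Orientations and regions\<close>

lemma phi_iff: "(u, v) \<in> phi h z \<longleftrightarrow> {u, v} \<in> climb_edges h \<and> lform u z < lform v z"
  by (simp add: phi_def lform_def)

text \<open>No edge is tied on \<open>Q\<close>, a common summand cancels from a comparison of
  forms, and form values strictly increase along directed paths.\<close>

lemma phi_coherent_acyclic:
  fixes z :: "real^'m::{finite,linorder}"
  assumes z: "z \<in> inside_out h" and h: "h \<ge> 1"
  shows "phi h z \<in> coherent_acyclic_orientations h"
proof -
  have "is_orientation (climb_edges h) (phi h z)"
    unfolding is_orientation_def phi_iff
    using edge_lform_neq[OF _ z h] by (force simp: insert_commute)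
  moreover have "coherent h (phi h z)"
    unfolding coherent_def
  proof (intro conjI allI impI)
    fix u :: "nat^'m::{finite,linorder}" assume e: "{0, u} \<in> climb_edges h"
    then have "u \<noteq> 0" using edge_lform_neq[OF e z h] by auto
    with e show "(0, u) \<in> phi h z" using lform_pos[OF z h] by (simp add: phi_iff)
  next
    fix a b c :: "nat^'m::{finite,linorder}"
    assume "a \<noteq> b" and le: "climb a + climb b \<le> h"
      and "a + c \<in> climb_verts h" "b + c \<in> climb_verts h"
    then have "{a + c, b + c} \<in> climb_edges h" by (intro climb_edgeI)
    moreover have "{a + 0, b + 0} \<in> climb_edges h"
      using \<open>a \<noteq> b\<close> le by (intro climb_edgeI) (auto simp: climb_verts_def)
    ultimately show "((a + c, b + c) \<in> phi h z) = ((a, b) \<in> phi h z)"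
      by (simp add: phi_iff lform_add)
  qed
  moreover have "acyclic (phi h z)"
  proof -
    have "lform u z < lform v z" if "(u, v) \<in> (phi h z)\<^sup>+" for u v
      using that by (induction rule: trancl_induct) (auto simp: phi_iff)
    then show ?thesis unfolding acyclic_def by fastforce
  qed
  ultimately show ?thesis by (simp add: coherent_acyclic_orientations_def)
qed

text \<open>By the intermediate value theorem, a difference of edge forms that changes sign on
  \<open>R\<close> vanishes somewhere in \<open>R\<close>, which no point of \<open>Q\<close>
  allows.\<close>

lemma phi_const_on_connected:
  fixes z w :: "real^'m::{finite,linorder}"
  assumes "connected R" "R \<subseteq> inside_out h" "z \<in> R" "w \<in> R" "h \<ge> 1"
  shows "phi h z = phi h w"
proof -
  \<comment> \<open>The two points are generalized here so that swapping them gives the reverse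
    inclusion.\<close>
  have *: "lform u w < lform v w"
    if e: "{u, v} \<in> climb_edges h" and lt: "lform u z < lform v z" and "z \<in> R" "w \<in> R"
    for u v and z w :: "real^'m::{finite,linorder}"
  proof (rule ccontr)
    let ?f = "\<lambda>x. lform v x - lform u x"
    assume nlt: "\<not> lform u w < lform v w"
    have "connected (?f ` R)"
      by (intro connected_continuous_image continuous_intros continuous_on_lform assms(1))
    then have "0 \<in> ?f ` R"
      using imageI[OF that(4), of ?f] imageI[OF that(3), of ?f]
      by (rule connectedD_interval) (use lt nlt in auto)
    then obtain x where "x \<in> R" "lform u x = lform v x" by auto
    then show False using edge_lform_neq[OF e _ assms(5)] assms(2) by blast
  qed
  then show ?thesis using assms(3,4) by (auto simp: phi_iff)
qed

text \<open>On the segment, a difference of edge forms is a convex combination of two nonzero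
  numbers of the same sign, so no hyperplane is met.\<close>

lemma phi_eq_segment:
  fixes z w :: "real^'m::{finite,linorder}"
  assumes "z \<in> inside_out h" "w \<in> inside_out h" "phi h z = phi h w"
  shows "closed_segment z w \<subseteq> inside_out h"
proof
  fix x assume "x \<in> closed_segment z w"
  then obtain t where t: "0 \<le> t" "t \<le> 1" "x = (1 - t) *\<^sub>R z + t *\<^sub>R w"
    by (auto simp: in_segment)
  have lx: "lform a x = (1 - t) * lform a z + t * lform a w" for a
    by (simp add: lform_def t(3) algebra_simps sum.distrib sum_distrib_left sum_subtractf)
  have "x \<in> std_simplex"
    using assms(1,2) t
    by (auto simp: inside_out_def std_simplex_def sum.distrib simp flip: sum_distrib_left)
  moreover have "x \<notin> H" if H: "H \<in> arrangement h" for H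
  proof
    assume "x \<in> H"
    obtain a b where ab: "{a, b} \<in> climb_edges h" "H = {z. lform a z = lform b z}"
      by (rule hyperplane_edge[OF H])
    have ne: "lform a z \<noteq> lform b z" "lform a w \<noteq> lform b w"
      using assms(1,2) H ab(2) by (auto simp: inside_out_def)
    have iff: "lform a z < lform b z \<longleftrightarrow> lform a w < lform b w"
      using assms(3) ab(1) phi_iff[of a b h] by blast
    have eq: "(1 - t) * (lform b z - lform a z) + t * (lform b w - lform a w) = 0"
      using \<open>x \<in> H\<close> ab(2) lx by (simp add: algebra_simps)
    have pos: "(1 - t) * p + t * q > 0" if "p > 0" "q > 0" for p q :: real
      using that t by (cases "t = 0") (auto intro: add_nonneg_pos)
    show False
    proof (cases "lform a z < lform b z")
      case True
      with iff pos[of "lform b z - lform a z" "lform b w - lform a w"] eq show False by simp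
    next
      case False
      with iff ne pos[of "lform a z - lform b z" "lform a w - lform b w"] eq show False
        by (simp add: algebra_simps)
    qed
  qed
  ultimately show "x \<in> inside_out h" by (auto simp: inside_out_def)
qed

text \<open>The segment is a connected subset of \<open>Q\<close> meeting \<open>R\<close> at
  \<open>z\<close>, so it lies in the component \<open>R\<close>; its end \<open>w\<close> is then
  common to both components.\<close>

lemma phi_eq_same_region:
  fixes R R' :: "(real^'m::{finite,linorder}) set"
  assumes "R \<in> regions h" "R' \<in> regions h" "z \<in> R" "w \<in> R'" "phi h z = phi h w"
  shows "R = R'" and "closed_segment z w \<subseteq> R"
proof -
  have R: "R \<in> components (inside_out h)" "R' \<in> components (inside_out h)"
    using assms(1,2) by (auto simp: regions_def)
  then have "z \<in> inside_out h" "w \<in> inside_out h"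
    using in_components_subset assms(3,4) by blast+
  then have "closed_segment z w \<subseteq> inside_out h" using assms(5) by (rule phi_eq_segment)
  moreover have "R \<inter> closed_segment z w \<noteq> {}" using assms(3) by auto
  ultimately show seg: "closed_segment z w \<subseteq> R"
    using components_maximal[OF R(1)] by blast
  then have "w \<in> R" by auto
  with R assms(4) show "R = R'" using components_nonoverlap by blast
qed

lemma phi_const_on_region:
  assumes "R \<in> regions h" "z \<in> R" "w \<in> R" "h \<ge> 1"
  shows "phi h z = phi h w"
  using assms phi_const_on_connected in_components_connected in_components_subset
  unfolding regions_def by metis

text \<open>Constancy of \<open>phi\<close> on \<open>R\<close> keeps segments between its points
  inside \<open>R\<close>, so \<open>R\<close> is convex, and nonempty convex sets have nonempty
  relative interior.\<close>

lemma rel_interior_region_nonempty: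
  assumes "R \<in> regions h" "h \<ge> 1"
  shows "rel_interior R \<noteq> {}"
proof -
  have "convex R"
    unfolding convex_contains_segment
    using phi_eq_same_region(2)[OF assms(1) assms(1)] phi_const_on_region[OF assms(1)] assms(2)
    by blast
  moreover have "R \<noteq> {}" using assms(1) in_components_nonempty unfolding regions_def by blast
  ultimately show ?thesis by (simp add: rel_interior_eq_empty)
qed

theorem theorem5p7:
  fixes h :: nat
  assumes "h \<ge> 2"
  shows "(\<forall>z \<in> (inside_out h :: (real^'m::{finite,linorder}) set).
            phi h z \<in> coherent_acyclic_orientations h)
       \<and> (\<forall>R \<in> (regions h :: (real^'m::{finite,linorder}) set set). \<forall>z \<in> R. \<forall>w \<in> R. phi h z = phi h w)
       \<and> (\<forall>R \<in> (regions h :: (real^'m::{finite,linorder}) set set). \<forall>R' \<in> regions h. R \<noteq> R' \<longrightarrow>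
            (\<forall>z \<in> R. \<forall>w \<in> R'. phi h z \<noteq> phi h w))
       \<and> (\<exists>\<Phi> :: (real^'m::{finite,linorder}) set \<Rightarrow> ((nat^'m::{finite,linorder}) \<times> (nat^'m::{finite,linorder})) set.
            \<Phi> \<in> open_regions h \<rightarrow> coherent_acyclic_orientations h
          \<and> inj_on \<Phi> (open_regions h)
          \<and> (\<forall>R \<in> regions h. \<forall>z \<in> R. \<Phi> (rel_interior R) = phi h z))"
proof (intro conjI)
  have h: "h \<ge> 1" using assms by simp
  show orient: "\<forall>z \<in> (inside_out h :: (real^'m::{finite,linorder}) set). phi h z \<in> coherent_acyclic_orientations h"
    using phi_coherent_acyclic[OF _ h] by blast
  show const: "\<forall>R \<in> (regions h :: (real^'m::{finite,linorder}) set set). \<forall>z \<in> R. \<forall>w \<in> R. phi h z = phi h w"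
    using phi_const_on_region[OF _ _ _ h] by blast
  show sep: "\<forall>R \<in> (regions h :: (real^'m::{finite,linorder}) set set). \<forall>R' \<in> regions h. R \<noteq> R' \<longrightarrow>
      (\<forall>z \<in> R. \<forall>w \<in> R'. phi h z \<noteq> phi h w)"
    using phi_eq_same_region(1) by blast
  \<comment> \<open>The orientation is read off at an arbitrary point of the open region; constancy
    on regions makes the choice immaterial.\<close>
  define \<Phi> where "\<Phi> = (\<lambda>S :: (real^'m::{finite,linorder}) set. phi h (SOME z. z \<in> S))"
  have \<Phi>: "\<Phi> (rel_interior R) = phi h z" if "R \<in> regions h" "z \<in> R" for R z
  proof -
    have "(SOME z. z \<in> rel_interior R) \<in> rel_interior R"
      using rel_interior_region_nonempty[OF that(1) h] by (simp add: some_in_eq)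
    then have "(SOME z. z \<in> rel_interior R) \<in> R" using rel_interior_subset by blast
    then show ?thesis unfolding \<Phi>_def using const that by blast
  qed
  have pt: "\<exists>z. z \<in> R \<and> z \<in> inside_out h" if "R \<in> regions h" for R :: "(real^'m::{finite,linorder}) set"
    using that in_components_nonempty in_components_subset unfolding regions_def by blast
  have "\<Phi> \<in> open_regions h \<rightarrow> coherent_acyclic_orientations h"
    unfolding open_regions_def using \<Phi> pt orient by fastforce
  moreover have "inj_on \<Phi> (open_regions h)"
    unfolding open_regions_def
  \<comment> \<open>Equal images force the underlying regions to coincide, hence also their relative
    interiors.\<close>
  proof (rule inj_onI, elim imageE)
    fix S S' R R' :: "(real^'m::{finite,linorder}) set"
    assume eq: "\<Phi> S = \<Phi> S'"
      and R: "S = rel_interior R" "R \<in> regions h" "S' = rel_interior R'" "R' \<in> regions h"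
    obtain z w where "z \<in> R" "w \<in> R'" using pt R by blast
    with eq R \<Phi> have "phi h z = phi h w" by metis
    with sep R \<open>z \<in> R\<close> \<open>w \<in> R'\<close> have "R = R'" by blast
    with R show "S = S'" by simp
  qed
  ultimately show "\<exists>\<Phi> :: (real^'m::{finite,linorder}) set \<Rightarrow> ((nat^'m::{finite,linorder}) \<times> (nat^'m::{finite,linorder})) set.
      \<Phi> \<in> open_regions h \<rightarrow> coherent_acyclic_orientations h
    \<and> inj_on \<Phi> (open_regions h)
    \<and> (\<forall>R \<in> regions h. \<forall>z \<in> R. \<Phi> (rel_interior R) = phi h z)"
    using \<Phi> by blast
qed

end
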